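(* Let $K\subset\mathbb{C}$ be bounded and convex, with diameter $s\geq 0$. Let $n$ and $k$ be positive integers with $k\leq n$, and let $\epsilon$ be a positive real number. If $$\frac{16(s+\epsilon)^2}{\epsilon^2}<\frac{k}{(n-k)^2},$$ then $K$ satisfies $\mathcal{RAGL}(n,k,\epsilon)$. Moreover, if $K$ is a disk (of diameter $s$), then the inequality $$\frac{8(s+\epsilon)}{\epsilon}<\frac{k}{(n-k)^2}$$ suffices to ensure that $K$ satisfies $\mathcal{RAGL}(n,k,\epsilon)$. (When $k=n$, the quantity $\frac{k}{(n-k)^2}$ is interpreted as $+\infty$, so that both inequalities hold.)
   Context: For a rational function $f\in\mathbb{C}(z)$ and a set $G\subset\mathbb{C}$, let $\#_z(f,G)$, $\#_p(f,G)$ and $\#_c(f,G)$ denote respectively the number of zeros, poles and critical points of $f$ lying in $G$, all counted with multiplicity; the critical points of $f$ are the zeros in $\mathbb{C}$ of the derivative $f'$. For $\epsilon>0$, $K_\epsilon=\{z\in\mathbb{C}: \inf_{w\in K}|z-w|<\epsilon\}$ denotes the $\epsilon$-neighborhood of $K$. Property $\mathcal{RAGL}(n,k,\epsilon)$ (rational approximate Gauss--Lucas property) of a set $K$: for every rational function $f\in\mathbb{C}(z)$ with $\#_z(f,\mathbb{C})+\#_p(f,\mathbb{C})=n$, if $\#_z(f,K)\geq k$ then $\#_c(f,K_\epsilon)\geq k-1$. *)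

theory Defs
  imports
    "HOL-Analysis.Analysis"
    "HOL-Computational_Algebra.Computational_Algebra"
    "HOL-Computational_Algebra.Field_as_Ring"
begin

text \<open>
  A rational function over the complex numbers is an element of the fraction field of
  \<^typ>\<open>complex poly\<close>, and \<^const>\<open>quot_of_fract\<close> yields its representation in lowest terms.
  Counts take values in \<^typ>\<open>enat\<close>: the zero polynomial vanishes to infinite order everywhere,
  so the zero function never has finitely many zeros in a nonempty set.
\<close>

type_synonym ratfun = "complex poly fract"

definition poly_zero_count :: "complex poly \<Rightarrow> complex set \<Rightarrow> enat" where
  "poly_zero_count p G =
     (if p = 0 then (if G = {} then 0 else \<infinity>)
      else enat (size (filter_mset (\<lambda>z. z \<in> G) (proots p))))"

definition zero_count :: "ratfun \<Rightarrow> complex set \<Rightarrow> enat" where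
  "zero_count f G = poly_zero_count (fst (quot_of_fract f)) G"

definition pole_count :: "ratfun \<Rightarrow> complex set \<Rightarrow> enat" where
  "pole_count f G = poly_zero_count (snd (quot_of_fract f)) G"

definition ratfun_deriv :: "ratfun \<Rightarrow> ratfun" where
  "ratfun_deriv f =
     (case quot_of_fract f of (p, q) \<Rightarrow> Fract (pderiv p * q - p * pderiv q) (q ^ 2))"

definition crit_count :: "ratfun \<Rightarrow> complex set \<Rightarrow> enat" where
  "crit_count f G = zero_count (ratfun_deriv f) G"

text \<open>
  The infimum is taken in \<^typ>\<open>ereal\<close>, so that the neighborhood of the empty set is empty
  (\<^const>\<open>infdist\<close> would make it the whole plane).
\<close>

definition eps_nbhd :: "complex set \<Rightarrow> real \<Rightarrow> complex set" where
  "eps_nbhd K \<epsilon> = {z. (INF w\<in>K. ereal (cmod (z - w))) < ereal \<epsilon>}"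

definition RAGL :: "nat \<Rightarrow> nat \<Rightarrow> real \<Rightarrow> complex set \<Rightarrow> bool" where
  "RAGL n k \<epsilon> K \<longleftrightarrow>
     (\<forall>f. zero_count f UNIV + pole_count f UNIV = enat n \<longrightarrow>
          zero_count f K \<ge> enat k \<longrightarrow>
          crit_count f (eps_nbhd K \<epsilon>) \<ge> enat (k - 1))"

text \<open>Both open and closed disks are admitted; the closed ones may degenerate to a point.\<close>

definition is_disk :: "complex set \<Rightarrow> bool" where
  "is_disk K \<longleftrightarrow> (\<exists>c r. (0 < r \<and> K = ball c r) \<or> (0 \<le> r \<and> K = cball c r))"

lemma ratfun_deriv_Fract:
  assumes "q \<noteq> 0"
  shows "ratfun_deriv (Fract p q) = Fract (pderiv p * q - p * pderiv q) (q ^ 2)"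
proof -
  obtain r s where rs: "quot_of_fract (Fract p q) = (r, s)" by fastforce
  hence "s \<noteq> 0"
    using quot_of_fract_in_normalized_fracts[of "Fract p q"] by auto
  have "Fract p q = Fract r s"
    using quot_to_fract_quot_of_fract[of "Fract p q"] by (simp add: rs quot_to_fract_def)
  hence eq: "p * s = r * q"
    using assms \<open>s \<noteq> 0\<close> by (simp add: eq_fract)
  from eq have "pderiv (p * s) = pderiv (r * q)" by simp
  hence deq: "p * pderiv s + s * pderiv p = r * pderiv q + q * pderiv r"
    by (simp add: pderiv_mult)
  have "(pderiv r * s - r * pderiv s) * q ^ 2 = (pderiv p * q - p * pderiv q) * s ^ 2"
    using eq deq by algebra
  thus ?thesis
    using assms \<open>s \<noteq> 0\<close> by (simp add: ratfun_deriv_def rs eq_fract)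
qed

lemma zero_count_Fract_coprime:
  assumes "coprime p q" "p \<noteq> 0" "q \<noteq> 0"
  shows "zero_count (Fract p q) G = enat (\<Sum>z | poly p z = 0 \<and> z \<in> G. order z p)"
    and "pole_count (Fract p q) G = enat (\<Sum>z | poly q z = 0 \<and> z \<in> G. order z q)"
proof -
  have size_eq: "poly_zero_count (smult c r) G = enat (\<Sum>z | poly r z = 0 \<and> z \<in> G. order z r)"
    if "r \<noteq> 0" "c \<noteq> 0" for r c
    using that by (auto simp: poly_zero_count_def size_multiset_overloaded_eq intro!: sum.cong)
  define a where "a = inverse (lead_coeff q)"
  have a: "a \<noteq> 0" using assms by (simp add: a_def)
  have "quot_of_fract (Fract p q) = (smult a p, smult a q)"
  proof -
    have eq: "Fract p q = quot_to_fract (smult a p, smult a q)"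
      using assms a by (simp add: quot_to_fract_def eq_fract)
    have "(smult a p, smult a q) \<in> normalized_fracts"
      using assms a
      by (auto simp: normalized_fracts_def unit_factor_poly_def a_def coprime_def
            dvd_smult_iff one_pCons)
    thus ?thesis unfolding eq by (rule quot_of_fract_quot_to_fract')
  qed
  thus "zero_count (Fract p q) G = enat (\<Sum>z | poly p z = 0 \<and> z \<in> G. order z p)"
    and "pole_count (Fract p q) G = enat (\<Sum>z | poly q z = 0 \<and> z \<in> G. order z q)"
    using size_eq[OF _ a] assms by (simp_all add: zero_count_def pole_count_def)
qed

lemma mem_eps_nbhd_iff: "z \<in> eps_nbhd K \<epsilon> \<longleftrightarrow> (\<exists>w\<in>K. cmod (z - w) < \<epsilon>)"
  by (simp add: eps_nbhd_def INF_less_iff)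

end

(*
  Write f = g h, where g collects the k' >= k zeros of f in K and h has at most n - k zeros
  and poles. By pigeonhole some \<delta> in (\<epsilon>/2, \<epsilon>) keeps the distance function of K away from \<delta>
  at all zeros and poles of h, so |h'/h| is at most 8 (n - k)^2 / \<epsilon> where the distance to K
  is \<delta>. There |g'/g| is at least k' \<delta> / (s + \<delta>)^2 by projecting each 1/(z - y) onto the
  outer normal of K (for a disk, k' / (s + \<delta>), since inversion maps disks to disks). Hence
  g'/g dominates h'/h, and comparing the numerator of f' with that of g' h by a Rouche argument
  shows that f' inherits the k' - 1 zeros that Gauss-Lucas gives to g'. Rouche's theorem is only
  needed for polynomials, where it follows from the continuity of roots, without contours.
*)

theory Submission
  imports Defs
begin

section \<open>Roots in a compact set under limits of coefficients\<close>

lemma size_filter_proots_mult: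
  assumes "p \<noteq> 0" "q \<noteq> 0"
  shows "size {#z \<in># proots (p * q). z \<in> C#} =
    size {#z \<in># proots p. z \<in> C#} + size {#z \<in># proots q. z \<in> C#}"
  using assms by (simp add: proots_mult)

lemma degree_linear_mult:
  fixes q :: "'a :: idom poly"
  shows "q \<noteq> 0 \<Longrightarrow> degree ([:- a, 1:] * q) = Suc (degree q)"
  by (subst degree_mult_eq) auto

text \<open>Synthetic division expresses each coefficient of the quotient through the next higher
  one and the coefficients of the product. Limits thus propagate downwards from index
  \<open>d\<close>, from which on all quotient coefficients vanish.\<close>

lemma tendsto_coeff_linear_quotient:
  fixes Q :: "'a :: real_normed_field poly"
  assumes lim: "\<And>i. (\<lambda>j. coeff ([:- w j, 1:] * P j) i) \<longlonglongrightarrow> coeff ([:- w0, 1:] * Q) i"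
    and w: "w \<longlonglongrightarrow> w0" and deg: "\<And>j. degree (P j) < d" "degree Q < d"
  shows "(\<lambda>j. coeff (P j) i) \<longlonglongrightarrow> coeff Q i"
proof (induction "d - i" arbitrary: i)
  case 0
  then have "degree (P j) < i" "degree Q < i" for j
    using deg(1)[of j] deg(2) by simp_all
  then show ?case by (simp add: coeff_eq_0)
next
  case (Suc x)
  have rec: "coeff R i = coeff ([:- v, 1:] * R) (Suc i) + v * coeff R (Suc i)" for v :: 'a and R
    by (simp add: coeff_pCons)
  have "(\<lambda>j. coeff ([:- w j, 1:] * P j) (Suc i) + w j * coeff (P j) (Suc i))
     \<longlonglongrightarrow> coeff ([:- w0, 1:] * Q) (Suc i) + w0 * coeff Q (Suc i)"
    using Suc by (intro tendsto_intros lim w) auto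
  then show ?case by (simp only: rec[symmetric])
qed

lemma tendsto_poly_coeffs:
  fixes Q :: "'a :: real_normed_field poly"
  assumes "\<And>i. (\<lambda>j. coeff (P j) i) \<longlonglongrightarrow> coeff Q i" "w \<longlonglongrightarrow> w0"
    and deg: "\<And>j. degree (P j) \<le> d" "degree Q \<le> d"
  shows "(\<lambda>j. poly (P j) (w j)) \<longlonglongrightarrow> poly Q w0"
proof -
  have eq: "poly R v = (\<Sum>i\<le>d. coeff R i * v ^ i)" if "degree R \<le> d" for R and v :: 'a
    by (subst poly_altdef, rule sum.mono_neutral_left) (use that in \<open>auto simp: coeff_eq_0\<close>)
  show ?thesis
    unfolding eq[OF deg(1)] eq[OF deg(2)] by (intro tendsto_intros assms)
qed

text \<open>Upper semicontinuity of the root count. Roots \<open>w j\<close> of \<open>P j\<close>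
  in \<open>C\<close> subconverge to a root of \<open>Q\<close> in \<open>C\<close>; dividing out
  these linear factors lowers \<open>c\<close> by one. Bounding the degrees by \<open>d\<close>,
  rather than fixing them, allows the degree to drop in the limit.\<close>

lemma size_filter_proots_limit:
  fixes Q :: "'a :: real_normed_field poly"
  assumes "compact C" "Q \<noteq> 0" "degree Q \<le> d"
    and "\<And>i. (\<lambda>j. coeff (P j) i) \<longlonglongrightarrow> coeff Q i"
    and "\<And>j. P j \<noteq> 0" "\<And>j. degree (P j) \<le> d" "\<And>j. c \<le> size {#z \<in># proots (P j). z \<in> C#}"
  shows "c \<le> size {#z \<in># proots Q. z \<in> C#}"
  using assms(2-)
proof (induction c arbitrary: P Q d)
  case 0
  then show ?case by simp
next
  case (Suc c)
  have "\<exists>v\<in>C. poly (P j) v = 0" for j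
  proof -
    have "{#z \<in># proots (P j). z \<in> C#} \<noteq> {#}"
      using Suc.prems(6)[of j] by (metis not_less_eq_eq size_empty zero_le)
    then obtain v where "v \<in># {#z \<in># proots (P j). z \<in> C#}" by blast
    then show ?thesis using Suc.prems(4)[of j] by auto
  qed
  then obtain w where w: "w j \<in> C" "poly (P j) (w j) = 0" for j by metis
  obtain w0 r where r: "w0 \<in> C" "strict_mono (r :: nat \<Rightarrow> nat)" "(w \<circ> r) \<longlonglongrightarrow> w0"
    using \<open>compact C\<close> w(1) unfolding compact_def by metis
  have Pr: "(\<lambda>j. coeff (P (r j)) i) \<longlonglongrightarrow> coeff Q i" for i
    using LIMSEQ_subseq_LIMSEQ[OF Suc.prems(3) r(2)] by (simp add: o_def)
  have "(\<lambda>j. poly (P (r j)) ((w \<circ> r) j)) \<longlonglongrightarrow> poly Q w0"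
    using Suc.prems by (intro tendsto_poly_coeffs[where d = d] Pr r(3)) auto
  then have "poly Q w0 = 0" using w(2) by (simp add: LIMSEQ_const_iff)
  then obtain Q' where Q': "Q = [:- w0, 1:] * Q'" by (auto simp only: poly_eq_0_iff_dvd dvd_def)
  have "\<exists>R. P j = [:- w j, 1:] * R" for j
    using w(2)[of j] by (simp only: poly_eq_0_iff_dvd dvd_def)
  then obtain P' where P': "P j = [:- w j, 1:] * P' j" for j by metis
  have nz: "Q' \<noteq> 0" "P' j \<noteq> 0" for j
    using Suc.prems(1) Suc.prems(4)[of j] Q' P'[of j] by (metis mult_zero_right)+
  have deg: "degree Q' < d" "degree (P' j) < d" for j
    using Suc.prems(2) Suc.prems(5)[of j] degree_linear_mult[OF nz(1), of w0]
      degree_linear_mult[OF nz(2), of "w j"] Q' P'[of j] by (metis Suc_le_lessD)+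
  have lim: "(\<lambda>j. coeff (P' (r j)) i) \<longlonglongrightarrow> coeff Q' i" for i
    by (rule tendsto_coeff_linear_quotient[OF Pr[unfolded P' Q'] _ deg(2) deg(1)])
      (use r(3) in \<open>simp add: o_def\<close>)
  \<comment> \<open>The factor removed from \<open>P (r j)\<close> has its root in \<open>C\<close>,
    so exactly one root is lost from the count.\<close>
  have "c \<le> size {#z \<in># proots (P' (r j)). z \<in> C#}" for j
  proof -
    have "Suc c \<le> size {#z \<in># proots [:- w (r j), 1:]. z \<in> C#} + size {#z \<in># proots (P' (r j)). z \<in> C#}"
      using Suc.prems(6)[of "r j"] size_filter_proots_mult[of "[:- w (r j), 1:]" "P' (r j)" C] nz(2)
      unfolding P'[of "r j"] by simp
    then show ?thesis using w(1) by simp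
  qed
  then have "c \<le> size {#z \<in># proots Q'. z \<in> C#}"
    using Suc.IH[of Q' d "\<lambda>j. P' (r j)"] nz deg lim by (simp add: less_imp_le)
  then show ?case
    using size_filter_proots_mult[of "[:- w0, 1:]" Q' C] nz(1) r(1) unfolding Q' by simp
qed

section \<open>Rouche's theorem for polynomials\<close>

text \<open>Cauchy's root bound: for \<open>norm z > 1\<close> each of the \<open>d\<close> lower
  terms is at most \<open>M * norm z ^ (d - 1)\<close>, and together they must balance the top term.
  The bound depends only on \<open>d\<close>, \<open>l\<close> and \<open>M\<close>, hence holds
  uniformly along a family of polynomials.\<close>

lemma poly_root_norm_le:
  fixes P :: "'a :: real_normed_field poly"
  assumes "degree P \<le> d" "0 < l" "l \<le> norm (coeff P d)" "\<And>i. norm (coeff P i) \<le> M" "poly P z = 0"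
  shows "norm z \<le> max 1 (real d * M / l)"
proof (cases "norm z \<le> 1")
  case False
  then have z: "norm z > 1" by simp
  have M: "0 \<le> M" using order_trans[OF norm_ge_zero assms(4)] by blast
  have eq: "poly P z = (\<Sum>i\<le>d. coeff P i * z ^ i)"
    by (subst poly_altdef, rule sum.mono_neutral_left) (use assms in \<open>auto simp: coeff_eq_0\<close>)
  show ?thesis
  proof (cases d)
    case 0
    then show ?thesis using eq assms by auto
  next
    case (Suc e)
    have top: "coeff P d * z ^ d = - (\<Sum>i\<le>e. coeff P i * z ^ i)"
      using eq assms(5) Suc by (simp add: eq_neg_iff_add_eq_0 add.commute)
    have "norm (coeff P d) * norm z ^ d = norm (coeff P d * z ^ d)"
      by (simp add: norm_mult norm_power)
    also have "\<dots> = norm (\<Sum>i\<le>e. coeff P i * z ^ i)"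
      unfolding top norm_minus_cancel ..
    also have "\<dots> \<le> (\<Sum>i\<le>e. M * norm z ^ e)"
      using z M by (intro sum_norm_le) (auto simp: norm_mult norm_power intro!: mult_mono assms power_increasing)
    also have "\<dots> = real d * M * norm z ^ e" using Suc by simp
    finally have "(norm (coeff P d) * norm z) * norm z ^ e \<le> (real d * M) * norm z ^ e"
      using Suc by (simp add: mult_ac)
    then have "norm (coeff P d) * norm z \<le> real d * M"
      by (rule mult_right_le_imp_le) (use z in \<open>intro zero_less_power, linarith\<close>)
    moreover have "l * norm z \<le> norm (coeff P d) * norm z" by (intro mult_right_mono assms) auto
    ultimately have "norm z \<le> real d * M / l" using assms(2) by (simp add: field_simps)
    then show ?thesis by simp
  qed
qed auto

text \<open>
  Along \<open>A + t B\<close>, having at least \<open>c\<close> roots in \<open>closure U\<close> and having more than \<open>d - c\<close> roots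
  outside \<open>U\<close> are complementary and both closed in \<open>t\<close>, so the first persists on \<open>[0, 1]\<close>.
\<close>

lemma polynomial_Rouche:
  fixes A B :: "complex poly"
  assumes U: "open U" "bounded U"
    and deg: "degree A \<le> d" "degree B \<le> d" "cmod (coeff B d) < cmod (coeff A d)"
    and less: "\<And>z. z \<in> frontier U \<Longrightarrow> cmod (poly B z) < cmod (poly A z)"
  shows "size {#z \<in># proots A. z \<in> U#} \<le> size {#z \<in># proots (A + B). z \<in> U#}"
proof -
  define P where "P t = A + smult (of_real t) B" for t
  \<comment> \<open>The gap at index \<open>d\<close> keeps the top coefficient of every
    \<open>P t\<close> away from 0, so the degree stays \<open>d\<close> and no root escapes to
    infinity.\<close>
  define l where "l = cmod (coeff A d) - cmod (coeff B d)"
  have l: "0 < l" using deg by (simp add: l_def)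
  have cont: "(\<lambda>j. coeff (P (x j)) i) \<longlonglongrightarrow> coeff (P t) i" if "x \<longlonglongrightarrow> t" for x t i
    unfolding P_def coeff_add coeff_smult by (intro tendsto_intros that)
  have coeff_d: "l \<le> cmod (coeff (P t) d)" if "t \<in> {0..1}" for t
  proof -
    have "cmod (of_real t * coeff B d) \<le> cmod (coeff B d)"
      using that by (simp add: norm_mult mult_left_le_one_le)
    moreover have "cmod (coeff A d) - cmod (of_real t * coeff B d) \<le> cmod (coeff (P t) d)"
      unfolding P_def coeff_add coeff_smult by (metis norm_diff_ineq)
    ultimately show ?thesis by (simp add: l_def)
  qed
  have degP: "degree (P t) \<le> d" for t
    unfolding P_def using deg by (intro degree_add_le) (auto intro: order_trans[OF degree_smult_le])
  have degP_eq: "degree (P t) = d" "P t \<noteq> 0" if "t \<in> {0..1}" for t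
  proof -
    have "coeff (P t) d \<noteq> 0" using coeff_d[OF that] l by auto
    then show "degree (P t) = d" "P t \<noteq> 0" using degP[of t] le_degree[of "P t" d] by auto
  qed
  define M where "M = (\<Sum>i\<le>d. cmod (coeff A i) + cmod (coeff B i))"
  have M: "cmod (coeff (P t) i) \<le> M" if "t \<in> {0..1}" for t i
  proof (cases "i \<le> d")
    case True
    have "cmod (coeff (P t) i) \<le> cmod (coeff A i) + cmod (of_real t * coeff B i)"
      unfolding P_def coeff_add coeff_smult by (rule norm_triangle_ineq)
    also have "\<dots> \<le> cmod (coeff A i) + cmod (coeff B i)"
      using that by (simp add: norm_mult mult_left_le_one_le)
    also have "\<dots> \<le> M" unfolding M_def using True by (intro member_le_sum) auto
    finally show ?thesis .
  next
    case False
    then have "coeff (P t) i = 0" using degP[of t] by (simp add: coeff_eq_0)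
    then show ?thesis unfolding M_def by (simp add: sum_nonneg)
  qed
  define R where "R = max 1 (real d * M / l)"
  have R: "z \<in> cball 0 R" if "t \<in> {0..1}" "poly (P t) z = 0" for t z
    using poly_root_norm_le[OF degP l coeff_d M] that by (simp add: R_def)
  have no_frontier: "poly (P t) z \<noteq> 0" if "t \<in> {0..1}" "z \<in> frontier U" for t z
  proof
    assume "poly (P t) z = 0"
    then have "poly A z = - (of_real t * poly B z)" by (simp add: P_def eq_neg_iff_add_eq_0)
    then have "cmod (poly A z) = t * cmod (poly B z)" using that by (simp add: norm_mult)
    also have "\<dots> \<le> cmod (poly B z)" using that by (simp add: mult_left_le_one_le)
    finally show False using less[OF that(2)] by simp
  qed
  define c where "c = size {#z \<in># proots A. z \<in> U#}"
  let ?N = "\<lambda>C t. size {#z \<in># proots (P t). z \<in> C#}"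
  have closed_N: "closed {t \<in> {0..1}. e \<le> ?N C t}" if "compact C" for C e
    unfolding closed_sequential_limits
  proof (intro allI impI, elim conjE)
    fix x t assume x: "\<forall>n. x n \<in> {t \<in> {0..1}. e \<le> ?N C t}" and lim: "x \<longlonglongrightarrow> t"
    have x01: "x n \<in> {0..1}" and xN: "e \<le> ?N C (x n)" for n using x by blast+
    have t: "t \<in> {0..1}" by (rule closed_sequentially[OF closed_atLeastAtMost x01 lim])
    have "e \<le> ?N C t"
      by (rule size_filter_proots_limit[OF that degP_eq(2)[OF t] degP cont[OF lim]
            degP_eq(2)[OF x01] degP xN])
    with t show "t \<in> {t \<in> {0..1}. e \<le> ?N C t}" by blast
  qed
  \<comment> \<open>Without roots on the frontier, the open set \<open>U\<close> can be traded for
    its compact closure.\<close>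
  have N_closure: "?N (closure U) t = ?N U t" if "t \<in> {0..1}" for t
  proof -
    have "z \<in> closure U \<longleftrightarrow> z \<in> U" if "z \<in># proots (P t)" for z
      using no_frontier[OF \<open>t \<in> _\<close>, of z] that degP_eq[OF \<open>t \<in> _\<close>] closure_subset[of U] U(1)
      by (auto simp: frontier_def interior_open)
    then show ?thesis by (intro arg_cong[where f = size] filter_mset_cong) auto
  qed
  \<comment> \<open>As all roots lie in \<open>cball 0 R\<close>, the roots outside \<open>U\<close>
    are counted by a compact set as well, and \<open>closed_N\<close> applies to both
    counts.\<close>
  have N_out: "?N U t + ?N (cball 0 R - U) t = d" if "t \<in> {0..1}" for t
  proof -
    have "{#z \<in># proots (P t). z \<in> cball 0 R - U#} = {#z \<in># proots (P t). z \<notin> U#}"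
      using R[OF that] degP_eq[OF that] by (intro filter_mset_cong) auto
    then have "?N U t + ?N (cball 0 R - U) t = size (proots (P t))"
      by (metis multiset_partition size_union)
    then show ?thesis by (simp add: size_proots_complex degP_eq[OF that])
  qed
  define S where "S = {t \<in> {0..1}. c \<le> ?N (closure U) t}"
  define T where "T = {t \<in> {0..1}. d - c + 1 \<le> ?N (cball 0 R - U) t}"
  have P0: "P 0 = A" and P1: "P 1 = A + B" by (auto simp: P_def)
  have c0: "c = ?N U 0" by (simp add: c_def P0)
  have c_le: "c \<le> d" using N_out[of 0] c0 by simp
  \<comment> \<open>The two counts add up to \<open>d\<close>, so one is at least \<open>c\<close>
    exactly when the other is at most \<open>d - c\<close>.\<close>
  have iff: "c \<le> ?N (closure U) t \<longleftrightarrow> \<not> d - c + 1 \<le> ?N (cball 0 R - U) t" if "t \<in> {0..1}" for t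
    using N_out[OF that] N_closure[OF that] c_le by linarith
  have S0: "0 \<in> S" using N_closure[of 0] c0 by (simp add: S_def)
  have "closed S" "closed T"
    unfolding S_def T_def using U
    by (intro closed_N; simp add: compact_closure compact_diff)+
  moreover have "connected {0..1::real}" by simp
  moreover have "{0..1} \<subseteq> S \<union> T" "S \<inter> T \<inter> {0..1} = {}" "S \<inter> {0..1} \<noteq> {}"
    using iff S0 by (auto simp: S_def T_def)
  ultimately have "T \<inter> {0..1} = {}" unfolding connected_closed by metis
  then have "1 \<notin> T" by auto
  then have "1 \<in> S" using iff[of 1] by (simp only: S_def T_def mem_Collect_eq) auto
  then show ?thesis using N_closure[of 1] by (simp add: S_def c_def P1)
qed

section \<open>Logarithmic derivatives\<close>

lemma poly_pderiv_prod_linear: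
  fixes z :: "'a :: field"
  assumes "z \<notin># M"
  shows "poly (pderiv (\<Prod>x\<in>#M. [:- x, 1:])) z = poly (\<Prod>x\<in>#M. [:- x, 1:]) z * (\<Sum>x\<in>#M. 1 / (z - x))"
  using assms
proof (induction M)
  case (add x M)
  let ?p = "\<Prod>x\<in>#M. [:- x, 1:]"
  from add have nz: "z - x \<noteq> 0" by auto
  have "poly (pderiv ([:- x, 1:] * ?p)) z = poly ?p z + (z - x) * poly (pderiv ?p) z"
    by (simp add: pderiv_mult pderiv_pCons algebra_simps del: mult_pCons_left)
  also have "\<dots> = (z - x) * poly ?p z * (1 / (z - x) + (\<Sum>x\<in>#M. 1 / (z - x)))"
    using add nz by (simp add: distrib_left)
  finally show ?case by (simp del: mult_pCons_left)
qed simp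

lemma poly_pderiv_proots:
  fixes p :: "complex poly"
  assumes "poly p z \<noteq> 0"
  shows "poly (pderiv p) z = poly p z * (\<Sum>x\<in>#proots p. 1 / (z - x))"
proof -
  have "z \<notin># proots p" using assms by (cases "p = 0") auto
  then have "poly (pderiv (smult (lead_coeff p) (\<Prod>x\<in>#proots p. [:- x, 1:]))) z =
      poly (smult (lead_coeff p) (\<Prod>x\<in>#proots p. [:- x, 1:])) z * (\<Sum>x\<in>#proots p. 1 / (z - x))"
    by (simp add: pderiv_smult poly_pderiv_prod_linear)
  then show ?thesis by (simp only: complex_poly_decompose_multiset)
qed

lemma norm_sum_mset_le:
  fixes f :: "'a \<Rightarrow> 'b :: real_normed_vector"
  assumes "\<And>x. x \<in># M \<Longrightarrow> norm (f x) \<le> c"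
  shows "norm (\<Sum>x\<in>#M. f x) \<le> real (size M) * c"
  using assms
proof (induction M)
  case (add x M)
  have "norm (f x + (\<Sum>x\<in>#M. f x)) \<le> norm (f x) + norm (\<Sum>x\<in>#M. f x)"
    by (rule norm_triangle_ineq)
  also have "\<dots> \<le> c + real (size M) * c" using add by (intro add_mono) auto
  finally show ?case by (simp add: algebra_simps)
qed simp

text \<open>After a common rotation by \<open>u\<close> all summands have real part at least
  \<open>L\<close>, and real parts add up without cancellation.\<close>

lemma norm_sum_inverse_ge:
  assumes "cmod u = 1" "\<And>x. x \<in># M \<Longrightarrow> L \<le> Re (u / (z - x))"
  shows "real (size M) * L \<le> cmod (\<Sum>x\<in>#M. 1 / (z - x))"
proof -
  have "real (size M) * L \<le> Re (u * (\<Sum>x\<in>#M. 1 / (z - x)))"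
    using assms(2)
  proof (induction M)
    case (add x M)
    have "real (size (add_mset x M)) * L = L + real (size M) * L" by (simp add: algebra_simps)
    also have "\<dots> \<le> Re (u / (z - x)) + Re (u * (\<Sum>x\<in>#M. 1 / (z - x)))"
      using add by (intro add_mono) auto
    also have "\<dots> = Re (u * (\<Sum>x\<in>#add_mset x M. 1 / (z - x)))"
      by (simp add: distrib_left del: times_complex.sel)
    finally show ?case .
  qed simp
  also have "\<dots> \<le> cmod (u * (\<Sum>x\<in>#M. 1 / (z - x)))" by (rule complex_Re_le_cmod)
  finally show ?thesis by (simp add: norm_mult assms(1))
qed

section \<open>Lower bounds for the real parts of rotated reciprocals\<close>

lemma Re_divide_inner: "Re (a / of_real h / b) = (a \<bullet> b) / h / (cmod b)\<^sup>2"
proof -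
  have "a / of_real h / b = a / b / of_real h" by simp
  then show ?thesis
    by (simp only: Re_divide_of_real) (simp add: Re_divide inner_complex_def cmod_power2)
qed

text \<open>Take \<open>u\<close> as the outer unit normal at the point \<open>w\<close> of
  \<open>closure K\<close> closest to \<open>z\<close>. Then \<open>Re (u / (z - y))\<close> is the
  inner product of \<open>u\<close> and \<open>z - y\<close>, at least \<delta> because
  \<open>K\<close> lies behind the supporting line at \<open>w\<close>, divided by the square of
  \<open>cmod (z - y)\<close>, which is at most \<open>diameter K + \<delta>\<close>.\<close>

lemma convex_inverse_bound:
  assumes "convex K" "bounded K" "K \<noteq> {}" "infdist z K = \<delta>" "0 < \<delta>"
  obtains u where "cmod u = 1" "\<And>y. y \<in> K \<Longrightarrow> \<delta> / (diameter K + \<delta>)\<^sup>2 \<le> Re (u / (z - y))"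
proof -
  define w where "w = closest_point (closure K) z"
  have w: "w \<in> closure K" "\<forall>y\<in>closure K. dist z w \<le> dist z y"
    using closest_point_exists[of "closure K" z] assms(3) by (auto simp: w_def)
  have dw: "cmod (z - w) = \<delta>"
    using setdist_closest_point[of "closure K" z] assms(3,4)
    by (simp add: w_def infdist_eq_setdist dist_norm)
  have "\<delta> / (diameter K + \<delta>)\<^sup>2 \<le> Re ((z - w) / of_real \<delta> / (z - y))" if y: "y \<in> K" for y
  proof -
    have y': "y \<in> closure K" using y closure_subset by auto
    \<comment> \<open>The variational inequality for the projection onto a closed convex
      set.\<close>
    have "(z - w) \<bullet> (y - w) \<le> 0"
      using any_closest_point_dot[of "closure K" w y z] assms w y' by (simp add: convex_closure)
    moreover have "(z - w) \<bullet> (z - y) = (cmod (z - w))\<^sup>2 - (z - w) \<bullet> (y - w)"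
      by (simp add: power2_norm_eq_inner inner_diff_right)
    ultimately have in_ge: "\<delta>\<^sup>2 \<le> (z - w) \<bullet> (z - y)" by (simp add: dw)
    then have nz: "z - y \<noteq> 0" using assms(5) by auto
    have "dist w y \<le> diameter K"
      using diameter_bounded_bound[of "closure K" w y] w y' bounded_closure[OF assms(2)] assms(2)
      by (simp add: diameter_closure)
    then have "cmod (z - y) \<le> diameter K + \<delta>"
      using dist_triangle[of z y w] dw by (simp add: dist_norm)
    moreover have "0 < diameter K + \<delta>" using diameter_ge_0[OF assms(2)] assms(5) by simp
    ultimately have "\<delta> / (diameter K + \<delta>)\<^sup>2 \<le> \<delta> / (cmod (z - y))\<^sup>2"
      using assms(5) nz by (intro divide_left_mono power_mono mult_pos_pos zero_less_power) auto
    also have "\<dots> = \<delta>\<^sup>2 / \<delta> / (cmod (z - y))\<^sup>2" using assms(5) by (simp add: power2_eq_square)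
    also have "\<dots> \<le> ((z - w) \<bullet> (z - y)) / \<delta> / (cmod (z - y))\<^sup>2"
      using assms(5) in_ge by (intro divide_right_mono) auto
    also have "\<dots> = Re ((z - w) / of_real \<delta> / (z - y))"
      by (simp only: Re_divide_inner)
    finally show ?thesis .
  qed
  moreover have "cmod ((z - w) / of_real \<delta>) = 1" using dw assms(5) by (simp add: norm_divide)
  ultimately show ?thesis using that by blast
qed

text \<open>Inversion at \<open>z\<close> maps the disk to a disk. With \<open>u\<close> pointing
  from \<open>c\<close> to \<open>z\<close>, the image is symmetric about the real axis and its
  leftmost point \<open>1 / (2 * r + \<delta>)\<close> comes from the point of the disk farthest
  from \<open>z\<close>. The proof verifies this by expanding squared norms.\<close>

lemma disk_inverse_bound:
  assumes "K \<subseteq> cball c r" "dist z c = r + \<delta>" "0 \<le> r" "0 < \<delta>"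
  obtains u where "cmod u = 1" "\<And>y. y \<in> K \<Longrightarrow> 1 / (2 * r + \<delta>) \<le> Re (u / (z - y))"
proof -
  define h where "h = r + \<delta>"
  have h: "cmod (z - c) = h" "0 < h" using assms by (auto simp: h_def dist_norm)
  have "1 / (2 * r + \<delta>) \<le> Re ((z - c) / of_real h / (z - y))" if y: "y \<in> K" for y
  proof -
    have yc: "cmod (y - c) \<le> r" using y assms(1) by (auto simp: dist_norm norm_minus_commute)
    have up: "cmod (z - y) \<le> 2 * r + \<delta>"
      using norm_triangle_ineq4[of "z - c" "y - c"] yc h by (simp add: h_def)
    have lo: "\<delta> \<le> cmod (z - y)"
      using norm_triangle_ineq2[of "z - c" "y - c"] yc h by (simp add: h_def)
    define V where "V = (cmod (z - y))\<^sup>2"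
    have V: "0 < V" "V \<le> (2 * r + \<delta>)\<^sup>2"
      using lo up assms(4) by (auto simp: V_def intro: power_mono)
    have "(cmod (y - c))\<^sup>2 = h\<^sup>2 + V - 2 * ((z - c) \<bullet> (z - y))"
      unfolding V_def h(1)[symmetric]
      by (simp add: power2_norm_eq_inner inner_diff_right inner_diff_left inner_commute)
    moreover have "(cmod (y - c))\<^sup>2 \<le> r\<^sup>2" using yc by (simp add: power_mono)
    \<comment> \<open>The constant is the power of the point \<open>z\<close>:
      \<open>h\<^sup>2 - r\<^sup>2 = \<delta> * (2 * r + \<delta>)\<close>.\<close>
    ultimately have in_ge: "V + \<delta> * (2 * r + \<delta>) \<le> 2 * ((z - c) \<bullet> (z - y))"
      by (simp add: h_def power2_eq_square algebra_simps)
    have pos: "0 < 2 * r + \<delta>" using assms by simp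
    have "2 * h * V = (2 * r + \<delta>) * V + \<delta> * V" by (simp add: h_def algebra_simps)
    also have "\<dots> \<le> (2 * r + \<delta>) * V + \<delta> * (2 * r + \<delta>)\<^sup>2"
      using V assms(4) by simp
    also have "\<dots> = (2 * r + \<delta>) * (V + \<delta> * (2 * r + \<delta>))" by (simp add: power2_eq_square algebra_simps)
    also have "\<dots> \<le> (2 * r + \<delta>) * (2 * ((z - c) \<bullet> (z - y)))"
      using pos in_ge by (intro mult_left_mono) auto
    finally have "h * V \<le> (2 * r + \<delta>) * ((z - c) \<bullet> (z - y))" by simp
    then have "1 / (2 * r + \<delta>) \<le> ((z - c) \<bullet> (z - y)) / h / V"
      using pos h V by (simp add: field_simps)
    also have "\<dots> = Re ((z - c) / of_real h / (z - y))"
      by (simp only: V_def Re_divide_inner)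
    finally show ?thesis .
  qed
  moreover have "cmod ((z - c) / of_real h) = 1" using h by (simp add: norm_divide)
  ultimately show ?thesis using that by blast
qed

section \<open>Distance to a disk, choice of the radius, and the Wronskian\<close>

lemma infdist_cball:
  fixes c :: "'a :: euclidean_space"
  assumes "0 \<le> r" "0 < infdist z (cball c r)"
  shows "dist z c = r + infdist z (cball c r)"
proof -
  have ne: "cball c r \<noteq> {}" using assms(1) by simp
  have "z \<notin> cball c r" using assms(2) by (metis infdist_zero less_irrefl)
  then have out: "r < norm (z - c)" by (simp add: dist_norm norm_minus_commute)
  \<comment> \<open>The radial projection of \<open>z\<close> onto the ball attains the
    distance.\<close>
  define w where "w = c + (r / norm (z - c)) *\<^sub>R (z - c)"
  have "z - w = (1 - r / norm (z - c)) *\<^sub>R (z - c)" by (simp add: w_def algebra_simps)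
  moreover have "r / norm (z - c) < 1" using out assms(1) by (simp add: divide_less_eq)
  ultimately have "dist z w = norm (z - c) - r"
    using out assms(1) le_less_trans[OF assms(1) out] by (simp add: dist_norm left_diff_distrib)
  moreover have "w \<in> cball c r" using assms(1) by (simp add: w_def dist_norm)
  ultimately have le: "infdist z (cball c r) \<le> norm (z - c) - r" using infdist_le by metis
  have "norm (z - c) - r \<le> dist z y" if "y \<in> cball c r" for y
    using dist_triangle[of z c y] that by (simp add: dist_norm norm_minus_commute)
  then have "norm (z - c) - r \<le> infdist z (cball c r)"
    using ne by (auto simp: infdist_def intro!: cINF_greatest simp del: mem_cball)
  with le show ?thesis by (simp add: dist_norm)
qed

text \<open>
  The \<open>size M + 1\<close> disjoint intervals of equal length filling \<open>(\<epsilon>/2, \<epsilon>)\<close> cannot all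
  contain a value of \<open>d\<close>; the midpoint of a free one serves as \<open>\<delta>\<close>.
\<close>

lemma exists_radius_away:
  fixes d :: "'a \<Rightarrow> real"
  assumes "0 < \<epsilon>"
  obtains \<delta> where "\<epsilon> / 2 < \<delta>" "\<delta> < \<epsilon>" "\<And>x. x \<in># M \<Longrightarrow> \<epsilon> / (4 * (real (size M) + 1)) \<le> \<bar>\<delta> - d x\<bar>"
proof -
  \<comment> \<open>Intervals of length \<open>2 * \<eta>\<close> are meant:
    \<open>size M + 1\<close> of them, centered at the \<open>m i\<close>, have total length
    \<epsilon>/2.\<close>
  define \<eta> where "\<eta> = \<epsilon> / (4 * (real (size M) + 1))"
  have \<eta>: "0 < \<eta>" "4 * (real (size M) + 1) * \<eta> = \<epsilon>" using assms by (auto simp: \<eta>_def)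
  define m where "m i = \<epsilon> / 2 + (2 * real i + 1) * \<eta>" for i :: nat
  have "\<exists>i\<le>size M. \<forall>x\<in>#M. \<eta> \<le> \<bar>m i - d x\<bar>"
  proof (rule ccontr)
    assume "\<not> ?thesis"
    then have "\<forall>i\<in>{..size M}. \<exists>x\<in>#M. \<bar>m i - d x\<bar> < \<eta>"
      by (metis atMost_iff not_le)
    then obtain x where x: "\<And>i. i \<le> size M \<Longrightarrow> x i \<in># M \<and> \<bar>m i - d (x i)\<bar> < \<eta>"
      by (metis atMost_iff)
    have "inj_on x {..size M}"
    proof (rule inj_onI)
      fix i j assume "i \<in> {..size M}" "j \<in> {..size M}" "x i = x j"
      then have "\<bar>m i - m j\<bar> < 2 * \<eta>" using x[of i] x[of j] by auto
      moreover have "m i - m j = 2 * \<eta> * (real i - real j)" by (simp add: m_def algebra_simps)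
      ultimately have "\<bar>real i - real j\<bar> < 1" using \<eta>(1) by (simp add: abs_mult)
      then show "i = j" by linarith
    qed
    then have "card {..size M} \<le> card (set_mset M)" using x by (intro card_inj_on_le) auto
    also have "\<dots> \<le> size M"
      by (metis mset_set_set_mset_msubset size_mset_mono size_mset_set)
    finally show False by simp
  qed
  then obtain i where i: "i \<le> size M" "\<forall>x\<in>#M. \<eta> \<le> \<bar>m i - d x\<bar>" by blast
  have "m i < \<epsilon>"
  proof -
    have "(2 * real i + 1) * \<eta> < 2 * (real (size M) + 1) * \<eta>"
      using i(1) \<eta>(1) by (intro mult_strict_right_mono) auto
    then show ?thesis unfolding m_def using \<eta>(2) by (simp only: algebra_simps)
  qed
  moreover have "\<epsilon> / 2 < m i" using \<eta>(1) by (simp add: m_def)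
  ultimately show ?thesis using that i(2) by (simp add: \<eta>_def)
qed

text \<open>
  The factor \<open>X\<close> makes the top index \<open>degree a + degree b\<close> instead of a truncated subtraction.
\<close>

lemma degree_coeff_wronskian:
  fixes a b :: "'a :: field_char_0 poly"
  defines "W \<equiv> pderiv a * b - a * pderiv b"
  shows "degree (pCons 0 W) \<le> degree a + degree b"
    and "coeff (pCons 0 W) (degree a + degree b) =
      (of_nat (degree a) - of_nat (degree b)) * (lead_coeff a * lead_coeff b)"
proof -
  have deg: "degree (pCons 0 (pderiv p)) \<le> degree p" for p :: "'a poly"
    by (cases "degree p = 0") (auto simp: degree_pCons_eq_if degree_pderiv pderiv_eq_0_iff)
  have co: "coeff (pCons 0 (pderiv p)) (degree p) = of_nat (degree p) * lead_coeff p" for p :: "'a poly"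
    by (cases "degree p") (auto simp: coeff_pderiv)
  \<comment> \<open>Reading the product at \<open>m + n\<close> stays valid if a factor has smaller
    degree, since both sides are then 0.\<close>
  have prod: "coeff (p * q) (m + n) = coeff p m * coeff q n"
    if "degree p \<le> m" "degree q \<le> n" for p q :: "'a poly" and m n
  proof (cases "degree p = m \<and> degree q = n")
    case True
    then show ?thesis using coeff_mult_degree_sum by blast
  next
    case False
    then have "degree p < m \<or> degree q < n" "degree (p * q) < m + n"
      using that degree_mult_le[of p q] by linarith+
    then show ?thesis by (auto simp: coeff_eq_0)
  qed
  have W: "pCons 0 W = pCons 0 (pderiv a) * b - a * pCons 0 (pderiv b)"
    by (simp add: W_def)
  show "degree (pCons 0 W) \<le> degree a + degree b"
    unfolding W using deg
    by (intro degree_diff_le order_trans[OF degree_mult_le] add_mono) auto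
  show "coeff (pCons 0 W) (degree a + degree b) =
      (of_nat (degree a) - of_nat (degree b)) * (lead_coeff a * lead_coeff b)"
    unfolding W coeff_diff prod[OF deg order_refl] prod[OF order_refl deg] co
    by (simp add: algebra_simps)
qed

section \<open>Neighborhoods of \<open>K\<close> and the Gauss-Lucas theorem\<close>

lemma infdist_lessE:
  assumes "infdist z K < \<delta>" "K \<noteq> {}"
  obtains w where "w \<in> K" "dist z w < \<delta>"
  using assms cINF_less_iff[of K "dist z" \<delta>] by (auto simp: infdist_def)

lemma bounded_infdist_less:
  assumes "bounded K" "K \<noteq> {}"
  shows "bounded {z. infdist z K < \<delta>}"
proof -
  obtain c r where cr: "K \<subseteq> cball c r" using assms(1) bounded_subset_cball by blast
  have "{z. infdist z K < \<delta>} \<subseteq> cball c (r + \<delta>)"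
  proof
    fix z assume "z \<in> {z. infdist z K < \<delta>}"
    then obtain w where "w \<in> K" "dist z w < \<delta>" using infdist_lessE assms(2) by blast
    then show "z \<in> cball c (r + \<delta>)"
      using cr dist_triangle[of c z w] by (auto simp: dist_commute)
  qed
  then show ?thesis using bounded_cball bounded_subset by blast
qed

lemma prod_linear_factors:
  fixes M :: "'a :: idom multiset"
  shows "degree (\<Prod>x\<in>#M. [:- x, 1:]) = size M"
    and "lead_coeff (\<Prod>x\<in>#M. [:- x, 1:]) = 1"
    and "(\<Prod>x\<in>#M. [:- x, 1:]) \<noteq> 0"
    and "poly (\<Prod>x\<in>#M. [:- x, 1:]) z = 0 \<longleftrightarrow> z \<in># M"
proof -
  have *: "degree (\<Prod>x\<in>#M. [:- x, 1:]) = size M \<and> lead_coeff (\<Prod>x\<in>#M. [:- x, 1:]) = 1"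
  proof (induction M)
    case (add x M)
    let ?p = "\<Prod>x\<in>#M. [:- x, 1:]"
    have "?p \<noteq> 0" using add by auto
    then have "degree ([:- x, 1:] * ?p) = size (add_mset x M)"
      using add degree_linear_mult[of ?p x] by (simp del: mult_pCons_left)
    moreover have "lead_coeff ([:- x, 1:] * ?p) = 1"
      unfolding lead_coeff_mult using conjunct2[OF add] by simp
    ultimately show ?case by (simp only: image_mset_add_mset prod_mset.add_mset)
  qed simp
  then show "degree (\<Prod>x\<in>#M. [:- x, 1:]) = size M" "lead_coeff (\<Prod>x\<in>#M. [:- x, 1:]) = 1" by auto
  show "(\<Prod>x\<in>#M. [:- x, 1:]) \<noteq> 0" using * by auto
  show "poly (\<Prod>x\<in>#M. [:- x, 1:]) z = 0 \<longleftrightarrow> z \<in># M"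
    by (induction M) auto
qed

text \<open>At positive distance from \<open>K\<close> the normal direction makes all terms of the
  logarithmic derivative point into one open half-plane, so their sum is not 0. Distance 0 already
  places \<open>z\<close> in every neighborhood of \<open>K\<close>.\<close>

lemma Gauss_Lucas_infdist:
  fixes K :: "complex set" and G :: "complex multiset"
  assumes "convex K" "bounded K" "set_mset G \<subseteq> K" "G \<noteq> {#}"
    and "poly (pderiv (\<Prod>x\<in>#G. [:- x, 1:])) z = 0"
  shows "infdist z K = 0"
proof (rule ccontr)
  assume ne: "infdist z K \<noteq> 0"
  then have pos: "0 < infdist z K" using infdist_nonneg[of z K] by linarith
  have K: "K \<noteq> {}" using assms(3,4) by auto
  obtain u where u: "cmod u = 1"
      "\<And>y. y \<in> K \<Longrightarrow> infdist z K / (diameter K + infdist z K)\<^sup>2 \<le> Re (u / (z - y))"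
    using convex_inverse_bound[OF assms(1,2) K refl pos] by blast
  have "z \<notin> K" using ne by auto
  then have z: "z \<notin># G" using assms(3) by auto
  have "0 < real (size G) * (infdist z K / (diameter K + infdist z K)\<^sup>2)"
  proof -
    have "0 < size G" using assms(4) by (metis nonempty_has_size)
    moreover have "0 < diameter K + infdist z K" using pos diameter_ge_0[OF assms(2)] by simp
    ultimately show ?thesis using pos by simp
  qed
  also have "\<dots> \<le> cmod (\<Sum>x\<in>#G. 1 / (z - x))"
    using assms(3) by (intro norm_sum_inverse_ge[OF u(1)] u(2)) auto
  finally have "(\<Sum>x\<in>#G. 1 / (z - x)) \<noteq> 0" by auto
  then show False
    using assms(5) z by (simp add: poly_pderiv_prod_linear prod_linear_factors)
qed

section \<open>Zeros of the numerator of the derivative\<close>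

text \<open>By the product rule the numerator for \<open>g * a / b\<close> is
  \<open>?A + ?B\<close>, where \<open>?A\<close> differentiates only \<open>g\<close> and
  \<open>?B\<close> only \<open>a / b\<close>. On the frontier of \<open>U\<close> the logarithmic
  derivative of \<open>g\<close> dominates, so Rouche applies. Besides the zeros of
  \<open>pderiv g\<close>, \<open>?A\<close> has those of \<open>b\<close>; they are kept in the
  count to pay for the later cancellation at poles.\<close>

lemma zeros_of_quotient_derivative:
  fixes G :: "complex multiset" and a b :: "complex poly" and K :: "complex set" and \<delta> \<eta> L :: real
  defines "g \<equiv> \<Prod>x\<in>#G. [:- x, 1:]" and "U \<equiv> {z. infdist z K < \<delta>}"
  assumes K: "convex K" "bounded K" and G: "set_mset G \<subseteq> K"
    and ab: "a \<noteq> 0" "b \<noteq> 0" "degree a + degree b < size G" and \<delta>: "0 < \<delta>" "0 < \<eta>"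
    and L: "\<And>z. infdist z K = \<delta> \<Longrightarrow> \<exists>u. cmod u = 1 \<and> (\<forall>y\<in>K. L \<le> Re (u / (z - y)))"
    and far: "\<And>x. x \<in># proots a + proots b \<Longrightarrow> \<eta> \<le> \<bar>\<delta> - infdist x K\<bar>"
    and small: "real (degree a + degree b) * (1 / \<eta>) < real (size G) * L"
  shows "size G - 1 + size {#z \<in># proots b. z \<in> U#}
    \<le> size {#z \<in># proots (pderiv (g * a) * b - g * a * pderiv b). z \<in> U#}"
proof -
  define W where "W = pderiv a * b - a * pderiv b"
  define d where "d = size G - 1 + (degree a + degree b)"
  let ?A = "pderiv g * (a * b)" and ?B = "g * W"
  have G_pos: "0 < size G" using ab(3) by simp
  then have G_ne: "G \<noteq> {#}" by auto
  have K_ne: "K \<noteq> {}" using G_ne G by auto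
  have g: "degree g = size G" "lead_coeff g = 1" "g \<noteq> 0" "poly g z = 0 \<longleftrightarrow> z \<in># G" for z
    unfolding g_def by (rule prod_linear_factors)+
  have g': "degree (pderiv g) = size G - 1" "pderiv g \<noteq> 0"
    using G_pos g(1) by (auto simp: degree_pderiv pderiv_eq_0_iff)
  have lc_g': "lead_coeff (pderiv g) = of_nat (size G)"
    using G_pos g(1,2) by (simp add: degree_pderiv coeff_pderiv flip: of_nat_Suc)
  have degA: "degree ?A = d" using g' ab(1,2) by (simp add: degree_mult_eq d_def)
  have coA: "coeff ?A d = of_nat (size G) * (lead_coeff a * lead_coeff b)"
    unfolding degA[symmetric] lead_coeff_mult lc_g' ..
  \<comment> \<open>The extra factor X avoids truncated subtraction: the coefficient of
    \<open>?B\<close> at \<open>d\<close> is read off at \<open>Suc d\<close>.\<close>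
  have pB: "pCons 0 ?B = g * pCons 0 W" by simp
  have dW: "degree (pCons 0 W) \<le> degree a + degree b" unfolding W_def by (rule degree_coeff_wronskian)
  have "degree (pCons 0 ?B) \<le> Suc d"
  proof -
    have "degree (g * pCons 0 W) \<le> size G + (degree a + degree b)"
      using degree_mult_le[of g "pCons 0 W"] dW g(1) by linarith
    then show ?thesis unfolding pB using G_pos by (simp add: d_def)
  qed
  then have degB: "degree ?B \<le> d" by (cases "?B = 0") auto
  \<comment> \<open>Rouche's condition at infinity: up to the common factor, the coefficients at
    \<open>d\<close> are \<open>degree a - degree b\<close> for \<open>?B\<close> and
    \<open>size G\<close> for \<open>?A\<close>.\<close>
  have "cmod (coeff ?B d) \<le> real (degree a + degree b) * cmod (lead_coeff a * lead_coeff b)"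
  proof -
    have Suc_d: "Suc d = degree g + (degree a + degree b)" using G_pos by (simp add: d_def g(1))
    have "coeff ?B d = coeff (g * pCons 0 W) (Suc d)" by (simp only: pB[symmetric] coeff_pCons_Suc)
    also have "\<dots> = coeff (pCons 0 W) (degree a + degree b)"
    proof (cases "degree (pCons 0 W) = degree a + degree b")
      case True
      then show ?thesis
        unfolding Suc_d using coeff_mult_degree_sum[of g "pCons 0 W"] g(2) by simp
    next
      case False
      then have "degree (pCons 0 W) < degree a + degree b" "degree (g * pCons 0 W) < Suc d"
        using dW degree_mult_le[of g "pCons 0 W"] Suc_d by linarith+
      then show ?thesis by (simp only: coeff_eq_0)
    qed
    also have "\<dots> = (of_nat (degree a) - of_nat (degree b)) * (lead_coeff a * lead_coeff b)"
      unfolding W_def by (rule degree_coeff_wronskian)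
    finally have "cmod (coeff ?B d) =
        cmod (of_nat (degree a) - of_nat (degree b)) * cmod (lead_coeff a * lead_coeff b)"
      by (simp only: norm_mult)
    moreover have "cmod (of_nat (degree a) - of_nat (degree b)) \<le> real (degree a + degree b)"
      using norm_triangle_ineq4[of "of_nat (degree a) :: complex" "of_nat (degree b)"] by simp
    ultimately show ?thesis by (metis mult_right_mono norm_ge_zero)
  qed
  also have "\<dots> < real (size G) * cmod (lead_coeff a * lead_coeff b)"
    using ab by (intro mult_strict_right_mono) auto
  also have "\<dots> = cmod (coeff ?A d)" unfolding coA by (simp add: norm_mult)
  finally have lead: "cmod (coeff ?B d) < cmod (coeff ?A d)" .
  have U: "open U" "bounded U"
    unfolding U_def
    by (intro open_Collect_less continuous_intros) (rule bounded_infdist_less[OF K(2) K_ne])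
  have frontier_U: "infdist z K = \<delta>" if "z \<in> frontier U" for z
  proof -
    have "closure U \<subseteq> {z. infdist z K \<le> \<delta>}"
      unfolding U_def by (intro closure_minimal closed_Collect_le continuous_intros) auto
    then show ?thesis using that U(1) by (auto simp: frontier_def interior_open U_def)
  qed
  have less: "cmod (poly ?B z) < cmod (poly ?A z)" if "z \<in> frontier U" for z
  proof -
    note z = frontier_U[OF that]
    obtain u where u: "cmod u = 1" "\<And>y. y \<in> K \<Longrightarrow> L \<le> Re (u / (z - y))" using L[OF z] by blast
    have "z \<notin> K" using z \<delta> by auto
    then have zG: "z \<notin># G" using G by auto
    \<comment> \<open>Since \<open>infdist\<close> is 1-Lipschitz, a gap between the distances to
      \<open>K\<close> bounds the distance of the points.\<close>
    have dist_x: "\<eta> \<le> cmod (z - x)" if "x \<in># proots a + proots b" for x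
      using far[OF that] infdist_triangle_abs[of z K x] z by (simp add: dist_norm)
    have "z \<notin># proots a + proots b" using dist_x[of z] \<delta>(2) by auto
    then have nz: "poly a z \<noteq> 0" "poly b z \<noteq> 0" using ab by auto
    have "poly W z = poly a z * poly b z * ((\<Sum>x\<in>#proots a. 1 / (z - x)) - (\<Sum>x\<in>#proots b. 1 / (z - x)))"
      by (simp add: W_def poly_pderiv_proots nz algebra_simps)
    moreover have "cmod ((\<Sum>x\<in>#proots a. 1 / (z - x)) - (\<Sum>x\<in>#proots b. 1 / (z - x)))
      \<le> real (degree a + degree b) * (1 / \<eta>)"
    proof -
      have "cmod (\<Sum>x\<in>#proots p. 1 / (z - x)) \<le> real (degree p) * (1 / \<eta>)"
        if "proots p \<subseteq># proots a + proots b" for p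
        unfolding size_proots_complex[symmetric]
      proof (rule norm_sum_mset_le)
        fix x assume "x \<in># proots p"
        then have "\<eta> \<le> cmod (z - x)" using that by (intro dist_x) (auto dest: mset_subset_eqD)
        then show "cmod (1 / (z - x)) \<le> 1 / \<eta>" using \<delta>(2) by (simp add: norm_divide frac_le)
      qed
      from this[of a] this[of b] show ?thesis
        using norm_triangle_ineq4[of "\<Sum>x\<in>#proots a. 1 / (z - x)" "\<Sum>x\<in>#proots b. 1 / (z - x)"]
        by (simp add: algebra_simps add_divide_distrib)
    qed
    moreover have "real (size G) * L \<le> cmod (\<Sum>x\<in>#G. 1 / (z - x))"
      using G by (intro norm_sum_inverse_ge[OF u(1)] u(2)) auto
    ultimately have "cmod (poly W z) < cmod (poly a z * poly b z) * cmod (\<Sum>x\<in>#G. 1 / (z - x))"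
      using small nz by (simp add: norm_mult)
    then have "cmod (poly g z) * cmod (poly W z)
        < cmod (poly g z) * (cmod (poly a z * poly b z) * cmod (\<Sum>x\<in>#G. 1 / (z - x)))"
      using g(4) zG by (intro mult_strict_left_mono) auto
    moreover have "poly (pderiv g) z = poly g z * (\<Sum>x\<in>#G. 1 / (z - x))"
      unfolding g_def by (rule poly_pderiv_prod_linear[OF zG])
    ultimately show ?thesis by (simp add: norm_mult mult_ac)
  qed
  have "size G - 1 + size {#z \<in># proots b. z \<in> U#} \<le> size {#z \<in># proots ?A. z \<in> U#}"
  proof -
    \<comment> \<open>Gauss-Lucas puts all \<open>size G - 1\<close> zeros of
      \<open>pderiv g\<close> into \<open>U\<close>.\<close>
    have "{#z \<in># proots (pderiv g). z \<in> U#} = proots (pderiv g)"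
    proof (rule filter_mset_eq_conv[THEN iffD2], safe)
    qed (use Gauss_Lucas_infdist[OF K G G_ne] g'(2) \<delta>(1) in \<open>auto simp: U_def g_def\<close>)
    then have "size {#z \<in># proots (pderiv g). z \<in> U#} = size G - 1"
      by (simp add: size_proots_complex g'(1))
    then show ?thesis using g'(2) ab by (simp add: size_filter_proots_mult)
  qed
  also have "\<dots> \<le> size {#z \<in># proots (?A + ?B). z \<in> U#}"
    by (rule polynomial_Rouche[OF U _ degB lead less]) (simp_all add: degA)
  also have "?A + ?B = pderiv (g * a) * b - g * a * pderiv b"
    by (simp add: W_def pderiv_mult algebra_simps)
  finally show ?thesis .
qed

section \<open>Cancellation at the poles\<close>

text \<open>At a zero of \<open>q\<close> of order m, \<open>pderiv p * q\<close> vanishes to order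
  at least m, but \<open>p * pderiv q\<close> only to order m - 1, because \<open>p\<close> does not
  vanish there and the characteristic is 0.\<close>

lemma order_quotient_derivative:
  fixes p q :: "'a :: field_char_0 poly"
  assumes "coprime p q" "q \<noteq> 0" "poly q z = 0" and P: "pderiv p * q - p * pderiv q \<noteq> 0"
  shows "order z (pderiv p * q - p * pderiv q) < order z q"
proof (rule ccontr)
  assume "\<not> ?thesis"
  then have "[:- z, 1:] ^ order z q dvd pderiv p * q - p * pderiv q"
    using order_divides P not_less by blast
  from dvd_diff[OF dvd_mult[OF order_1] this, of "pderiv p"]
  have dvd: "[:- z, 1:] ^ order z q dvd p * pderiv q" by simp
  have pz: "poly p z \<noteq> 0"
    using assms(1,3) coprime_poly_0 by blast
  have ord: "order z q = Suc (order z (pderiv q))"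
    using assms(2,3) by (rule order_pderiv)
  have "pderiv q \<noteq> 0"
  proof
    assume "pderiv q = 0"
    then obtain c where "q = [:c:]" using degree_eq_zeroE by (auto simp: pderiv_eq_0_iff)
    with assms(2,3) show False by simp
  qed
  then have nz: "p * pderiv q \<noteq> 0" using pz by auto
  then have "order z q \<le> order z (p * pderiv q)" using dvd order_divides by blast
  also have "\<dots> = order z (pderiv q)" using order_mult[OF nz] order_0I[OF pz] by simp
  finally show False using ord by simp
qed

text \<open>The equation says that \<open>N / D\<close> represents the derivative of
  \<open>p / q\<close>. Away from the zeros of \<open>q\<close> nothing but zeros of
  \<open>D\<close> can cancel, so all zeros of the numerator survive in \<open>N\<close>; at a zero
  of \<open>q\<close> the numerator has smaller order than \<open>q\<close>, and
  \<open>proots q\<close> absorbs it.\<close>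

lemma proots_quotient_derivative_subset:
  fixes p q N D :: "complex poly"
  assumes "coprime p q" "q \<noteq> 0" "D \<noteq> 0"
    and eq: "(pderiv p * q - p * pderiv q) * D = N * q\<^sup>2"
  shows "proots (pderiv p * q - p * pderiv q) \<subseteq># proots N + proots q"
proof (cases "pderiv p * q - p * pderiv q = 0")
  case False
  let ?P = "pderiv p * q - p * pderiv q"
  have "?P * D \<noteq> 0" using False assms(3) by simp
  with eq have N: "N \<noteq> 0" by auto
  have "order z ?P \<le> order z N + order z q" for z
  proof (cases "poly q z = 0")
    case True
    then show ?thesis using order_quotient_derivative[OF assms(1,2) True False] by simp
  next
    case nz: False
    then have "order z q = 0" by (simp add: order_0I)
    moreover have "order z ?P + order z D = order z N + order z (q\<^sup>2)"
      using eq \<open>?P * D \<noteq> 0\<close> by (metis order_mult)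
    moreover have "order z (q\<^sup>2) = 0" using nz by (simp add: order_0I)
    ultimately show ?thesis by simp
  qed
  then show ?thesis using False N assms(2) by (simp add: subseteq_mset_def)
qed simp

text \<open>Passing to lowest terms costs at most the zeros of \<open>q\<close> in \<open>U\<close>,
  which is the surplus in the second assumption.\<close>

lemma crit_count_ge:
  fixes f :: ratfun
  assumes pq: "quot_of_fract f = (p, q)"
    and ge: "m + size {#z \<in># proots q. z \<in> U#} \<le> size {#z \<in># proots (pderiv p * q - p * pderiv q). z \<in> U#}"
    and "U \<subseteq> V"
  shows "enat m \<le> crit_count f V"
proof -
  obtain N D where ND: "quot_of_fract (ratfun_deriv f) = (N, D)" by fastforce
  have q: "q \<noteq> 0" "coprime p q"
    using quot_of_fract_in_normalized_fracts[of f] pq by (auto simp: normalized_fracts_def)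
  have D: "D \<noteq> 0" using quot_of_fract_in_normalized_fracts[of "ratfun_deriv f"] ND by auto
  have "ratfun_deriv f = Fract N D"
    using quot_to_fract_quot_of_fract[of "ratfun_deriv f"] by (simp add: ND quot_to_fract_def)
  moreover have "ratfun_deriv f = Fract (pderiv p * q - p * pderiv q) (q\<^sup>2)"
    by (simp add: ratfun_deriv_def pq)
  ultimately have eq: "(pderiv p * q - p * pderiv q) * D = N * q\<^sup>2"
    using q D by (simp add: eq_fract)
  show ?thesis
  proof (cases "N = 0")
    \<comment> \<open>A zero derivative has infinite count on a nonempty \<open>V\<close>; for empty
      \<open>V\<close>, also \<open>U\<close> is empty and \<open>ge\<close> forces
      \<open>m = 0\<close>.\<close>
    case True
    show ?thesis
    proof (cases "V = {}")
      case True
      then show ?thesis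
        using ge \<open>U \<subseteq> V\<close> by (simp add: zero_enat_def[symmetric])
    qed (use True in \<open>simp add: crit_count_def zero_count_def poly_zero_count_def ND\<close>)
  next
    case False
    let ?c = "\<lambda>p. size {#z \<in># proots p. z \<in> U#}"
    have "?c (pderiv p * q - p * pderiv q) \<le> size {#z \<in># proots N + proots q. z \<in> U#}"
      using proots_quotient_derivative_subset[OF q(2,1) D eq]
      by (intro size_mset_mono multiset_filter_mono)
    then have "m \<le> ?c N" using ge by simp
    also have "\<dots> \<le> size {#z \<in># proots N. z \<in> V#}"
      using \<open>U \<subseteq> V\<close> by (intro size_mset_mono) (auto simp: subseteq_mset_def)
    finally show ?thesis
      using False by (simp add: crit_count_def zero_count_def poly_zero_count_def ND)
  qed
qed

section \<open>The approximate Gauss-Lucas property and its constants\<close>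

text \<open>The bound \<open>L\<close> is the only geometric input, so that convex sets and disks
  share one argument. In \<open>small\<close>, the left side bounds the logarithmic derivative of
  the factor formed by the at most \<open>n - k\<close> other zeros and poles.\<close>

lemma RAGL_of_inverse_bound:
  assumes K: "convex K" "bounded K" and "0 < \<epsilon>" "0 < L" "0 < k" "n - k < k"
    and L: "\<And>\<delta> z. \<epsilon> / 2 < \<delta> \<Longrightarrow> \<delta> < \<epsilon> \<Longrightarrow> infdist z K = \<delta> \<Longrightarrow> K \<noteq> {} \<Longrightarrow>
      \<exists>u. cmod u = 1 \<and> (\<forall>y\<in>K. L \<le> Re (u / (z - y)))"
    and small: "real (n - k) * (4 * (real (n - k) + 1) / \<epsilon>) < real k * L"
  shows "RAGL n k \<epsilon> K"
  unfolding RAGL_def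
proof (intro allI impI)
  fix f :: ratfun
  assume n: "zero_count f UNIV + pole_count f UNIV = enat n" and k: "enat k \<le> zero_count f K"
  obtain p q where pq: "quot_of_fract f = (p, q)" by fastforce
  have q: "q \<noteq> 0" "coprime p q"
    using quot_of_fract_in_normalized_fracts[of f] pq by (auto simp: normalized_fracts_def)
  \<comment> \<open>The zero function has infinitely many zeros and is excluded by the finite total
    \<open>n\<close>.\<close>
  have p: "p \<noteq> 0" using n by (auto simp: zero_count_def poly_zero_count_def pq)
  have n_eq: "degree p + degree q = n"
    using n p q(1) by (simp add: zero_count_def pole_count_def poly_zero_count_def pq size_proots_complex)
  define G where "G = {#z \<in># proots p. z \<in> K#}"
  \<comment> \<open>The leading coefficient goes into \<open>a\<close>, leaving the factor with the
    zeros in \<open>K\<close> monic.\<close>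
  define a where "a = smult (lead_coeff p) (\<Prod>x\<in># {#z \<in># proots p. z \<notin> K#}. [:- x, 1:])"
  have k_le: "k \<le> size G" using k p by (simp add: zero_count_def poly_zero_count_def pq G_def)
  have a: "a \<noteq> 0"
    unfolding a_def using p by (metis leading_coeff_0_iff prod_linear_factors(3) smult_eq_0_iff)
  have "size (proots p) = size G + size {#z \<in># proots p. z \<notin> K#}"
    unfolding G_def by (metis multiset_partition size_union)
  moreover have "degree a = size {#z \<in># proots p. z \<notin> K#}"
    unfolding a_def using p by (simp only: degree_smult_eq leading_coeff_0_iff prod_linear_factors if_False)
  ultimately have deg_a: "degree a + size G = degree p"
    by (simp add: size_proots_complex)
  have p_eq: "p = (\<Prod>x\<in>#G. [:- x, 1:]) * a"
  proof -
    have "p = smult (lead_coeff p) (\<Prod>x\<in>#proots p. [:- x, 1:])"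
      by (simp add: complex_poly_decompose_multiset)
    also have "proots p = G + {#z \<in># proots p. z \<notin> K#}"
      unfolding G_def by (rule multiset_partition)
    finally show ?thesis by (simp add: a_def)
  qed
  have m_le: "degree a + degree q \<le> n - k" using deg_a k_le n_eq by linarith
  have K_ne: "K \<noteq> {}" using k_le \<open>0 < k\<close> by (auto simp: G_def)
  define M where "M = proots a + proots q"
  have size_M: "size M = degree a + degree q" by (simp add: M_def size_proots_complex)
  obtain \<delta> where \<delta>: "\<epsilon> / 2 < \<delta>" "\<delta> < \<epsilon>"
      "\<And>x. x \<in># M \<Longrightarrow> \<epsilon> / (4 * (real (size M) + 1)) \<le> \<bar>\<delta> - infdist x K\<bar>"
    using exists_radius_away[OF \<open>0 < \<epsilon>\<close>, of M "\<lambda>x. infdist x K"] by blast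
  define \<eta> where "\<eta> = \<epsilon> / (4 * (real (size M) + 1))"
  \<comment> \<open>\<open>M\<close> may have fewer than \<open>n - k\<close> elements; the estimate
    increases with its size.\<close>
  have "real (degree a + degree q) * (1 / \<eta>) \<le> real (n - k) * (4 * (real (n - k) + 1) / \<epsilon>)"
    unfolding \<eta>_def size_M using m_le \<open>0 < \<epsilon>\<close>
    by (simp only: divide_divide_eq_right mult_1)
      (intro mult_mono divide_right_mono; simp)
  also have "\<dots> < real k * L" by (rule small)
  also have "\<dots> \<le> real (size G) * L" using k_le \<open>0 < L\<close> by simp
  finally have small': "real (degree a + degree q) * (1 / \<eta>) < real (size G) * L" .
  have "size G - 1 + size {#z \<in># proots q. z \<in> {z. infdist z K < \<delta>}#}
    \<le> size {#z \<in># proots (pderiv p * q - p * pderiv q). z \<in> {z. infdist z K < \<delta>}#}"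
    unfolding p_eq
  proof (rule zeros_of_quotient_derivative[OF K _ a q(1) _ _ _ _ _ small'])
    show "set_mset G \<subseteq> K" by (auto simp: G_def)
    show "degree a + degree q < size G" using m_le k_le \<open>n - k < k\<close> by linarith
    show "0 < \<delta>" using \<delta>(1) \<open>0 < \<epsilon>\<close> by simp
    show "0 < \<eta>" using \<open>0 < \<epsilon>\<close> by (simp add: \<eta>_def)
    show "\<exists>u. cmod u = 1 \<and> (\<forall>y\<in>K. L \<le> Re (u / (z - y)))" if "infdist z K = \<delta>" for z
      using L[OF \<delta>(1,2) that K_ne] .
    show "\<eta> \<le> \<bar>\<delta> - infdist x K\<bar>" if "x \<in># proots a + proots q" for x
      using \<delta>(3) that by (simp add: \<eta>_def M_def)
  qed
  then have "enat (size G - 1) \<le> crit_count f (eps_nbhd K \<epsilon>)"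
  proof (rule crit_count_ge[OF pq])
    show "{z. infdist z K < \<delta>} \<subseteq> eps_nbhd K \<epsilon>"
    proof
      fix z assume "z \<in> {z. infdist z K < \<delta>}"
      then obtain w where "w \<in> K" "dist z w < \<delta>" using infdist_lessE K_ne by blast
      then show "z \<in> eps_nbhd K \<epsilon>" using \<delta>(2)
        by (auto simp: mem_eps_nbhd_iff dist_norm intro: less_trans)
    qed
  qed
  moreover have "enat (k - 1) \<le> enat (size G - 1)" using k_le by simp
  ultimately show "enat (k - 1) \<le> crit_count f (eps_nbhd K \<epsilon>)" by (rule order_trans[rotated])
qed

text \<open>For m = n - k \<ge> 1 one has m (m + 1) \<le> 2 m^2, which costs the factor 2. The case
  \<open>k = n\<close> is a separate disjunct because division by 0 yields 0 instead of infinity;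
  there the left side vanishes.\<close>

lemma mult_successor_less:
  assumes "k = n \<or> 2 * c < real k / (real n - real k)\<^sup>2" "0 < k" "k \<le> n" "0 \<le> c"
  shows "real (n - k) * (real (n - k) + 1) * c < real k"
proof (cases "k = n")
  case False
  define m where "m = real (n - k)"
  have m: "1 \<le> m" "real n - real k = m" using False assms(3) by (auto simp: m_def of_nat_diff)
  have "m * (m + 1) * c \<le> m * (2 * m) * c"
    using m assms(4) by (intro mult_right_mono mult_left_mono) auto
  also have "\<dots> = 2 * c * m\<^sup>2" by (simp add: power2_eq_square)
  also have "\<dots> < real k"
    using assms(1) False m by (simp add: pos_less_divide_eq)
  finally show ?thesis by (simp add: m_def)
qed (use assms in simp)

theorem theorem1p1:
  fixes K :: "complex set" and s \<epsilon> :: real and n k :: nat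
  assumes "bounded K" and "convex K" and "s = diameter K"
    and "0 < n" and "0 < k" and "k \<le> n" and "0 < \<epsilon>"
  shows "(k = n \<or> 16 * (s + \<epsilon>)\<^sup>2 / \<epsilon>\<^sup>2 < real k / (real n - real k)\<^sup>2
            \<longrightarrow> RAGL n k \<epsilon> K)
       \<and> (is_disk K \<longrightarrow>
            k = n \<or> 8 * (s + \<epsilon>) / \<epsilon> < real k / (real n - real k)\<^sup>2
            \<longrightarrow> RAGL n k \<epsilon> K)"
proof (intro conjI impI)
  have s: "0 \<le> s" using assms(1,3) diameter_ge_0 by blast
  \<comment> \<open>The numerical hypothesis already forces fewer other zeros and poles than
    \<open>k\<close>, since m \<le> m (m + 1) \<open>c\<close>.\<close>
  have fewer: "n - k < k" if "real (n - k) * (real (n - k) + 1) * c < real k" "1 \<le> c" for c :: real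
  proof -
    have "real (n - k) \<le> real (n - k) * (real (n - k) + 1)"
      by (cases "n - k") (auto simp: field_simps)
    also have "\<dots> \<le> real (n - k) * (real (n - k) + 1) * c"
      using that(2) mult_left_mono[of 1 c "real (n - k) * (real (n - k) + 1)"] by simp
    finally show ?thesis using that(1) by linarith
  qed
  {
    assume "k = n \<or> 16 * (s + \<epsilon>)\<^sup>2 / \<epsilon>\<^sup>2 < real k / (real n - real k)\<^sup>2"
    then have *: "real (n - k) * (real (n - k) + 1) * (8 * (s + \<epsilon>)\<^sup>2 / \<epsilon>\<^sup>2) < real k"
      using assms by (intro mult_successor_less) auto
    have "\<epsilon>\<^sup>2 \<le> (s + \<epsilon>)\<^sup>2" using s assms(7) by (intro power_mono) auto
    then have **: "1 \<le> 8 * (s + \<epsilon>)\<^sup>2 / \<epsilon>\<^sup>2"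
      using assms(7) zero_le_power2[of "s + \<epsilon>"]
      by (simp only: le_divide_eq_1_pos zero_less_power)
    \<comment> \<open>A lower bound for \<open>\<delta> / (s + \<delta>)\<^sup>2\<close> on
      (\<epsilon>/2, \<epsilon>): the numerator is taken at the left end and the denominator at the
      right end.\<close>
    define L where "L = (\<epsilon> / 2) / (s + \<epsilon>)\<^sup>2"
    have L_pos: "0 < L" using s assms(7) by (simp add: L_def)
    show "RAGL n k \<epsilon> K"
    proof (rule RAGL_of_inverse_bound[OF assms(2,1,7) L_pos assms(5) fewer[OF * **]])
      fix \<delta> z assume \<delta>: "\<epsilon> / 2 < \<delta>" "\<delta> < \<epsilon>" "infdist z K = \<delta>" "K \<noteq> {}"
      then have pos: "0 < \<delta>" using assms(7) by simp
      obtain u where u: "cmod u = 1" "\<And>y. y \<in> K \<Longrightarrow> \<delta> / (diameter K + \<delta>)\<^sup>2 \<le> Re (u / (z - y))"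
        using convex_inverse_bound[OF assms(2,1) \<delta>(4,3) pos] by blast
      have "L \<le> \<delta> / (s + \<delta>)\<^sup>2"
        unfolding L_def using \<delta> s pos by (intro frac_le power_mono) auto
      then show "\<exists>u. cmod u = 1 \<and> (\<forall>y\<in>K. L \<le> Re (u / (z - y)))"
        using u assms(3) order_trans by blast
    next
      \<comment> \<open>The 8 is half of 16, and its product with \<open>L\<close> is the
        4/\<epsilon> of the pigeonhole spacing.\<close>
      have "8 * t\<^sup>2 / \<epsilon>\<^sup>2 * (\<epsilon> / 2 / t\<^sup>2) = 4 / \<epsilon>" if "t \<noteq> 0" for t :: real
        using assms(7) that by (simp add: power2_eq_square)
      from this[of "s + \<epsilon>"] have "8 * (s + \<epsilon>)\<^sup>2 / \<epsilon>\<^sup>2 * L = 4 / \<epsilon>"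
        unfolding L_def using assms(7) s by linarith
      then have "real (n - k) * (4 * (real (n - k) + 1) / \<epsilon>)
          = real (n - k) * (real (n - k) + 1) * (8 * (s + \<epsilon>)\<^sup>2 / \<epsilon>\<^sup>2) * L"
        by (simp only: mult.assoc) simp
      also have "\<dots> < real k * L" using * L_pos by (intro mult_strict_right_mono)
      finally show "real (n - k) * (4 * (real (n - k) + 1) / \<epsilon>) < real k * L" .
    qed
  next
    assume disk: "is_disk K" and "k = n \<or> 8 * (s + \<epsilon>) / \<epsilon> < real k / (real n - real k)\<^sup>2"
    then have *: "real (n - k) * (real (n - k) + 1) * (4 * (s + \<epsilon>) / \<epsilon>) < real k"
      using assms s by (intro mult_successor_less) auto
    have **: "1 \<le> 4 * (s + \<epsilon>) / \<epsilon>" using assms(7) s by simp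
    obtain c r where "0 < r \<and> K = ball c r \<or> 0 \<le> r \<and> K = cball c r"
      using disk unfolding is_disk_def by blast
    \<comment> \<open>Open and closed disks are treated together through their common closure, which
      has the same distance function.\<close>
    then have r: "0 \<le> r" "K \<subseteq> cball c r" "closure K = cball c r" "s = 2 * r"
      using assms(3) by auto
    \<comment> \<open>Here \<open>1 / (2 * r + \<delta>)\<close> decreases in \<delta>, so only
      \<delta> < \<epsilon> matters and the factor 2 from the numerator of the convex case is
      saved.\<close>
    define L where "L = 1 / (s + \<epsilon>)"
    have L_pos: "0 < L" using s assms(7) by (simp add: L_def)
    show "RAGL n k \<epsilon> K"
    proof (rule RAGL_of_inverse_bound[OF assms(2,1,7) L_pos assms(5) fewer[OF * **]])
      fix \<delta> z assume \<delta>: "\<epsilon> / 2 < \<delta>" "\<delta> < \<epsilon>" "infdist z K = \<delta>" "K \<noteq> {}"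
      then have pos: "0 < \<delta>" using assms(7) by simp
      have "infdist z (cball c r) = \<delta>"
        using \<delta>(3) by (simp flip: r(3) add: infdist_eq_setdist)
      then have "dist z c = r + \<delta>" using infdist_cball[OF r(1), of z c] pos by simp
      then obtain u where u: "cmod u = 1" "\<And>y. y \<in> K \<Longrightarrow> 1 / (2 * r + \<delta>) \<le> Re (u / (z - y))"
        using disk_inverse_bound[OF r(2) _ r(1) pos] by blast
      have "L \<le> 1 / (2 * r + \<delta>)"
        unfolding L_def r(4) using \<delta>(2) r(1) pos by (intro divide_left_mono) auto
      then show "\<exists>u. cmod u = 1 \<and> (\<forall>y\<in>K. L \<le> Re (u / (z - y)))"
        using u order_trans by blast
    next
      have "4 * t / \<epsilon> * (1 / t) = 4 / \<epsilon>" if "t \<noteq> 0" for t :: real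
        using that by simp
      from this[of "s + \<epsilon>"] have "4 * (s + \<epsilon>) / \<epsilon> * L = 4 / \<epsilon>"
        using assms(7) s by (simp add: L_def)
      then have "real (n - k) * (4 * (real (n - k) + 1) / \<epsilon>)
          = real (n - k) * (real (n - k) + 1) * (4 * (s + \<epsilon>) / \<epsilon>) * L"
        by (simp only: mult.assoc) simp
      also have "\<dots> < real k * L" using * L_pos by (intro mult_strict_right_mono)
      finally show "real (n - k) * (4 * (real (n - k) + 1) / \<epsilon>) < real k * L" .
    qed
  }
qed

end
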